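(* Let $X, Y, Z, W$ be Banach spaces such that $X$ and $Y$ embed continuously into $Z$. Let $A: Z\to W$ and $A_n: Z\to W$ ($n\in\mathbb{N}$, $n\ge 1$) be continuous linear operators such that for all $n\geq 1$ \[ \|A_n - A\|_{L(X,W)} \leq C_X\, n^{-\alpha}, \qquad \|A_n-A\|_{L(Y,W)} \geq c_Y\, n^{-\beta}, \qquad \|A_n - A\|_{L(Z,W)}\leq C_Z \] for real numbers $\beta<\alpha$ and constants $C_X, c_Y, C_Z>0$. For $t>0$ define \[ \rho(t) = \sup_{\|y\|_Y\leq 1}\ \inf_{\|x\|_X\leq t} \|x-y\|_Z . \] Then \[ \rho(t) \geq 2^{-\beta}\, \frac{\left( c_Y/2\right)^{\frac{\alpha}{\alpha-\beta}}}{C_Z\,C_X^{\frac{\beta}{\alpha-\beta}}}\,t^{-\frac{\beta}{\alpha-\beta}}\qquad\text{for all } t\geq \frac{c_Y}{2C_X} \] and \[ \liminf_{t\to\infty} \left(t^{\frac{\beta}{\alpha-\beta}}\, \rho(t) \right) \geq \frac{\left( c_Y/2\right)^{\frac{\alpha}{\alpha-\beta}}}{C_Z\,C_X^{\frac{\beta}{\alpha-\beta}}}. \]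
   Context: For Banach spaces $U,V$, $L(U,V)$ is the space of continuous linear maps $U\to V$ with the operator norm. The norms $\|A_n-A\|_{L(X,W)}$ and $\|A_n-A\|_{L(Y,W)}$ are the operator norms of the restrictions of $A_n-A$ to $X$ and $Y$ via the continuous embeddings, e.g. $\|A_n-A\|_{L(X,W)}=\sup_{\|x\|_X\le 1}\|(A_n-A)x\|_W$. Elements of $X$ and $Y$ are identified with their images in $Z$ when computing $\|x-y\|_Z$. *)

theory Defs
  imports "HOL-Analysis.Analysis" "HOL-Library.Extended_Real" "HOL-Library.Liminf_Limsup"
begin

text \<open>
  A Banach space \<open>X\<close> continuously embedded into \<open>Z\<close> is given by a type \<open>'x :: banach\<close> carrying its
  own norm together with an injective continuous linear map \<open>i :: 'x \<Rightarrow>\<^sub>L 'z\<close>. The restriction of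
  \<open>T : Z \<rightarrow> W\<close> to \<open>X\<close> is then \<open>T o\<^sub>L i\<close>. Complex Banach spaces are covered by restricting the
  scalars, which changes neither continuity nor operator norms.
\<close>

definition continuous_embedding :: "('x::banach \<Rightarrow>\<^sub>L 'z::banach) \<Rightarrow> bool" where
  "continuous_embedding i \<longleftrightarrow> inj (blinfun_apply i)"

text \<open>
  For \<open>t \<ge> 0\<close> both extrema are genuine real ones: the infimum is over a nonempty set bounded
  below by \<open>0\<close>, and, taking \<open>x = 0\<close>, it is at most \<open>norm iY\<close> for every \<open>y\<close> in the unit ball.
\<close>

definition approx_rho ::
  "('x::banach \<Rightarrow>\<^sub>L 'z::banach) \<Rightarrow> ('y::banach \<Rightarrow>\<^sub>L 'z) \<Rightarrow> real \<Rightarrow> real" where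
  "approx_rho iX iY t =
     (SUP y\<in>{y. norm y \<le> 1}. INF x\<in>{x. norm x \<le> t}. norm (blinfun_apply iX x - blinfun_apply iY y))"

end

theory Submission
  imports Defs "HOL-Real_Asymp.Real_Asymp"
begin

text \<open>
  Splitting \<open>y = x + (y - x)\<close> and applying \<open>T = A\<^sub>n - A\<close> gives
  \<open>\<parallel>T\<parallel>\<^bsub>L(Y,W)\<^esub> \<le> \<parallel>T\<parallel>\<^bsub>L(Z,W)\<^esub> \<rho>(t) + t \<parallel>T\<parallel>\<^bsub>L(X,W)\<^esub>\<close>, hence
  \<open>C\<^sub>Z \<rho>(t) \<ge> c\<^sub>Y n powr -\<beta> - t C\<^sub>X n powr -\<alpha>\<close>.
  With \<open>s = (2 C\<^sub>X t / c\<^sub>Y) powr (1 / (\<alpha> - \<beta>))\<close>, every \<open>n \<ge> s\<close> makes the subtracted term at most half of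
  the first one; the choice \<open>n = \<lceil>s\<rceil> \<le> s + 1\<close> yields both bounds. Boundedness of \<open>A\<^sub>n - A\<close> on \<open>Z\<close>
  forces \<open>\<beta> \<ge> 0\<close>, which makes \<open>n powr -\<beta>\<close> decreasing in \<open>n\<close>.
\<close>

lemma norm_blinfun_le_on_cball:
  fixes f :: "'a::real_normed_vector \<Rightarrow>\<^sub>L 'b::real_normed_vector"
  assumes "0 \<le> b" and bound: "\<And>x. norm x \<le> 1 \<Longrightarrow> norm (blinfun_apply f x) \<le> b"
  shows "norm f \<le> b"
proof (rule norm_blinfun_bound[OF \<open>0 \<le> b\<close>])
  fix x
  show "norm (blinfun_apply f x) \<le> b * norm x"
  proof (cases "x = 0")
    case False
    then have "norm (blinfun_apply f (x /\<^sub>R norm x)) \<le> b"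
      by (intro bound) simp
    with False show ?thesis
      by (simp add: blinfun.scaleR_right field_simps)
  qed simp
qed

text \<open>A supremum of reals dominates its members only if the family is bounded above. The
  competitor \<open>x = 0\<close>, admissible because \<open>0 \<le> t\<close>, bounds every infimum
  by \<open>norm iY\<close>, uniformly in \<open>y\<close>.\<close>

lemma INF_le_approx_rho:
  fixes iX :: "'x::banach \<Rightarrow>\<^sub>L 'z::banach" and iY :: "'y::banach \<Rightarrow>\<^sub>L 'z"
  assumes "0 \<le> t" "norm y \<le> 1"
  shows "(INF x\<in>{x. norm x \<le> t}. norm (blinfun_apply iX x - blinfun_apply iY y)) \<le> approx_rho iX iY t"
  unfolding approx_rho_def
proof (rule cSUP_upper)
  show "y \<in> {y. norm y \<le> 1}" using assms by simp
  show "bdd_above ((\<lambda>y. INF x\<in>{x. norm x \<le> t}. norm (blinfun_apply iX x - blinfun_apply iY y)) ` {y. norm y \<le> 1})"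
  proof (rule bdd_aboveI2)
    fix y :: 'y assume "y \<in> {y. norm y \<le> 1}"
    then have "norm (blinfun_apply iY y) \<le> norm iY"
      using norm_blinfun[of iY y] mult_left_mono[of "norm y" 1 "norm iY"] by simp
    moreover have "(INF x\<in>{x. norm x \<le> t}. norm (blinfun_apply iX x - blinfun_apply iY y))
        \<le> norm (blinfun_apply iX 0 - blinfun_apply iY y)"
      using \<open>0 \<le> t\<close> by (intro cINF_lower bdd_belowI2[where m = 0]) auto
    ultimately show "(INF x\<in>{x. norm x \<le> t}. norm (blinfun_apply iX x - blinfun_apply iY y)) \<le> norm iY"
      by simp
  qed
qed

text \<open>The witness is \<open>y = 0\<close>, whose infimum of norms is nonnegative. The sign is
  what later allows \<open>norm (An n - A)\<close> to be replaced by \<open>C\<^sub>Z\<close> in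
  front of \<rho>.\<close>

lemma approx_rho_nonneg:
  assumes "0 \<le> t"
  shows "0 \<le> approx_rho iX iY t"
proof -
  have "0 \<le> (INF x\<in>{x. norm x \<le> t}. norm (blinfun_apply iX x - blinfun_apply iY 0))"
    using assms by (intro cINF_greatest) (auto intro: exI[of _ 0])
  also have "\<dots> \<le> approx_rho iX iY t"
    by (rule INF_le_approx_rho) (use assms in auto)
  finally show ?thesis .
qed

lemma norm_compose_le_approx_rho:
  fixes iX :: "'x::banach \<Rightarrow>\<^sub>L 'z::banach" and iY :: "'y::banach \<Rightarrow>\<^sub>L 'z"
    and T :: "'z \<Rightarrow>\<^sub>L 'w::real_normed_vector"
  assumes "0 \<le> t"
  shows "norm (T o\<^sub>L iY) \<le> norm T * approx_rho iX iY t + norm (T o\<^sub>L iX) * t"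
proof (cases "norm T = 0")
  case True
  then show ?thesis by simp
next
  case False
  then have T: "0 < norm T" by simp
  show ?thesis
  proof (rule norm_blinfun_le_on_cball)
    show "0 \<le> norm T * approx_rho iX iY t + norm (T o\<^sub>L iX) * t"
      using assms by (intro add_nonneg_nonneg mult_nonneg_nonneg approx_rho_nonneg) auto
    fix y :: 'y assume y: "norm y \<le> 1"
    let ?v = "norm (blinfun_apply (T o\<^sub>L iY) y)"
    \<comment> \<open>The infimum need not be attained, so no best \<open>x\<close> is chosen. The
      triangle inequality is solved for the distance instead, giving a lower bound independent of
      \<open>x\<close>; this division is why \<open>norm T = 0\<close> is treated apart.\<close>
    have "(?v - norm (T o\<^sub>L iX) * t) / norm T
        \<le> (INF x\<in>{x. norm x \<le> t}. norm (blinfun_apply iX x - blinfun_apply iY y))"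
    proof (rule cINF_greatest)
      show "{x::'x. norm x \<le> t} \<noteq> {}" using assms by (auto intro: exI[of _ 0])
      fix x :: 'x assume "x \<in> {x. norm x \<le> t}"
      then have x: "norm x \<le> t" by simp
      have "blinfun_apply (T o\<^sub>L iY) y
          = blinfun_apply (T o\<^sub>L iX) x - blinfun_apply T (blinfun_apply iX x - blinfun_apply iY y)"
        by (simp add: blinfun.diff_right)
      then have "?v \<le> norm (blinfun_apply (T o\<^sub>L iX) x)
          + norm (blinfun_apply T (blinfun_apply iX x - blinfun_apply iY y))"
        using norm_triangle_ineq4 by metis
      also have "\<dots> \<le> norm (T o\<^sub>L iX) * t + norm T * norm (blinfun_apply iX x - blinfun_apply iY y)"
        by (intro add_mono norm_blinfun order_trans[OF norm_blinfun] mult_left_mono x) simp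
      finally show "(?v - norm (T o\<^sub>L iX) * t) / norm T \<le> norm (blinfun_apply iX x - blinfun_apply iY y)"
        using T by (simp add: field_simps)
    qed
    also have "\<dots> \<le> approx_rho iX iY t"
      by (rule INF_le_approx_rho[OF assms y])
    finally show "?v \<le> norm T * approx_rho iX iY t + norm (T o\<^sub>L iX) * t"
      using T by (simp add: field_simps)
  qed
qed

text \<open>For negative \<beta> the powers have a positive exponent and tend to infinity, so they
  eventually exceed \<open>M / c\<close>.\<close>

lemma nonneg_exponent_if_powr_bounded:
  fixes \<beta> c M :: real
  assumes "0 < c" and bound: "\<And>n::nat. n \<ge> 1 \<Longrightarrow> c * real n powr (- \<beta>) \<le> M"
  shows "0 \<le> \<beta>"
proof (rule ccontr)
  assume "\<not> 0 \<le> \<beta>"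
  then have "filterlim (\<lambda>n. real n powr (- \<beta>)) at_top sequentially"
    by real_asymp
  then have "\<forall>\<^sub>F n in sequentially. M / c < real n powr (- \<beta>)"
    by (simp add: filterlim_at_top_dense)
  then have "\<forall>\<^sub>F n in sequentially. M / c < real n powr (- \<beta>) \<and> n \<ge> 1"
    using eventually_ge_at_top eventually_conj by blast
  then obtain n where "M / c < real n powr (- \<beta>)" "n \<ge> 1"
    by (auto dest: eventually_happens)
  with bound[of n] \<open>0 < c\<close> show False
    by (simp add: field_simps)
qed

text \<open>The threshold is the \<open>n\<close> at which
  \<open>n powr (\<alpha> - \<beta>)\<close> equals \<open>2 * a * t / c\<close>, that is, where
  both sides agree. Since \<alpha> - \<beta> is positive, larger \<open>n\<close> only favour the
  right-hand side.\<close>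

lemma balanced_index_powr:
  fixes \<alpha> \<beta> a c t n :: real
  assumes "\<beta> < \<alpha>" "0 < a" "0 < c" "0 < t" "(2 * a * t / c) powr (1 / (\<alpha> - \<beta>)) \<le> n"
  shows "a * t * n powr (- \<alpha>) \<le> c / 2 * n powr (- \<beta>)"
proof -
  have pos: "0 < 2 * a * t / c" using assms by simp
  have n: "0 < n"
    using assms(5) pos by (smt (verit) powr_gt_zero)
  have "2 * a * t / c = ((2 * a * t / c) powr (1 / (\<alpha> - \<beta>))) powr (\<alpha> - \<beta>)"
    using pos assms by (simp add: powr_powr)
  also have "\<dots> \<le> n powr (\<alpha> - \<beta>)"
    using assms by (intro powr_mono2) auto
  finally have "a * t \<le> c / 2 * n powr (\<alpha> - \<beta>)"
    using assms by (simp add: field_simps)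
  then have "a * t * n powr (- \<alpha>) \<le> c / 2 * n powr (\<alpha> - \<beta>) * n powr (- \<alpha>)"
    by (rule mult_right_mono) simp
  also have "\<dots> = c / 2 * n powr (- \<beta>)"
    by (simp add: powr_add[symmetric])
  finally show ?thesis .
qed

theorem lemma2p1:
  fixes iX :: "'x::banach \<Rightarrow>\<^sub>L 'z::banach"
    and iY :: "'y::banach \<Rightarrow>\<^sub>L 'z"
    and A :: "'z \<Rightarrow>\<^sub>L 'w::banach"
    and An :: "nat \<Rightarrow> ('z \<Rightarrow>\<^sub>L 'w)"
    and \<alpha> \<beta> C\<^sub>X c\<^sub>Y C\<^sub>Z :: real
  assumes "continuous_embedding iX" and "continuous_embedding iY"
    and "\<beta> < \<alpha>" and "C\<^sub>X > 0" and "c\<^sub>Y > 0" and "C\<^sub>Z > 0"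
    and "\<And>n. n \<ge> 1 \<Longrightarrow> norm ((An n - A) o\<^sub>L iX) \<le> C\<^sub>X * real n powr (- \<alpha>)"
    and "\<And>n. n \<ge> 1 \<Longrightarrow> norm ((An n - A) o\<^sub>L iY) \<ge> c\<^sub>Y * real n powr (- \<beta>)"
    and "\<And>n. n \<ge> 1 \<Longrightarrow> norm (An n - A) \<le> C\<^sub>Z"
  shows "(\<forall>t \<ge> c\<^sub>Y / (2 * C\<^sub>X).
            approx_rho iX iY t \<ge>
              2 powr (- \<beta>) * ((c\<^sub>Y / 2) powr (\<alpha> / (\<alpha> - \<beta>)) / (C\<^sub>Z * C\<^sub>X powr (\<beta> / (\<alpha> - \<beta>))))
                * t powr (- (\<beta> / (\<alpha> - \<beta>))))
       \<and> Liminf at_top (\<lambda>t::real. ereal (t powr (\<beta> / (\<alpha> - \<beta>)) * approx_rho iX iY t)) \<ge>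
           ereal ((c\<^sub>Y / 2) powr (\<alpha> / (\<alpha> - \<beta>)) / (C\<^sub>Z * C\<^sub>X powr (\<beta> / (\<alpha> - \<beta>))))"
proof -
  define \<gamma> where "\<gamma> = \<beta> / (\<alpha> - \<beta>)"
  define K where "K = (c\<^sub>Y / 2) powr (\<alpha> / (\<alpha> - \<beta>)) / (C\<^sub>Z * C\<^sub>X powr \<gamma>)"
  define s where "s t = (2 * C\<^sub>X * t / c\<^sub>Y) powr (1 / (\<alpha> - \<beta>))" for t
  define t\<^sub>0 where "t\<^sub>0 = c\<^sub>Y / (2 * C\<^sub>X)"
  note pos = \<open>C\<^sub>X > 0\<close> \<open>c\<^sub>Y > 0\<close> \<open>C\<^sub>Z > 0\<close> and upperX = assms(7) and lowerY = assms(8) and upperZ = assms(9)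
  have "0 < t\<^sub>0" and "K > 0" using pos by (simp_all add: t\<^sub>0_def K_def)

  have "0 \<le> \<beta>"
  proof (rule nonneg_exponent_if_powr_bounded[OF \<open>c\<^sub>Y > 0\<close>])
    fix n :: nat assume n: "n \<ge> 1"
    have "c\<^sub>Y * real n powr (- \<beta>) \<le> norm ((An n - A) o\<^sub>L iY)" by (rule lowerY[OF n])
    also have "\<dots> \<le> norm (An n - A) * norm iY" by (rule norm_blinfun_compose)
    also have "\<dots> \<le> C\<^sub>Z * norm iY" by (intro mult_right_mono upperZ[OF n]) simp
    finally show "c\<^sub>Y * real n powr (- \<beta>) \<le> C\<^sub>Z * norm iY" .
  qed

  \<comment> \<open>\<open>t\<^sub>0\<close> is the point where \<open>s\<close> takes the value 1.
    Beyond it the rounded index is admissible and \<open>1 + 1 / s t\<close> is at most 2.\<close>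
  have s_ge_1: "1 \<le> s t" if "t\<^sub>0 \<le> t" for t
    using that pos \<open>\<beta> < \<alpha>\<close> by (auto simp: s_def t\<^sub>0_def field_simps intro!: ge_one_powr_ge_zero)

  \<comment> \<open>This explains the constant \<open>K\<close>: it is what the estimate would give
    if the unrounded \<open>s t\<close> could serve as index.\<close>
  have K_eq: "c\<^sub>Y / 2 * s t powr (- \<beta>) = C\<^sub>Z * K * t powr (- \<gamma>)" if "0 < t" for t
  proof -
    have "\<alpha> / (\<alpha> - \<beta>) = 1 + \<gamma>" using \<open>\<beta> < \<alpha>\<close> by (simp add: \<gamma>_def field_simps)
    then have K: "C\<^sub>Z * K = c\<^sub>Y / 2 * (c\<^sub>Y / 2) powr \<gamma> * C\<^sub>X powr (- \<gamma>)"
      using pos by (simp add: K_def powr_add powr_minus_divide)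
    have "s t powr (- \<beta>) = (C\<^sub>X * t / (c\<^sub>Y / 2)) powr (- \<gamma>)"
      by (simp add: s_def powr_powr \<gamma>_def mult_ac)
    also have "\<dots> = C\<^sub>X powr (- \<gamma>) * t powr (- \<gamma>) * (c\<^sub>Y / 2) powr \<gamma>"
      using pos that by (simp only: powr_mult powr_divide powr_minus) (simp add: field_simps)
    finally show ?thesis unfolding K by simp
  qed

  \<comment> \<open>The loss from rounding is kept as an explicit factor, so that both claims
    follow: it is at least \<open>2 powr (- \<beta>)\<close> from \<open>t\<^sub>0\<close> on, and
    it tends to 1.\<close>
  have key: "K * (1 + 1 / s t) powr (- \<beta>) * t powr (- \<gamma>) \<le> approx_rho iX iY t" if t: "t\<^sub>0 \<le> t" for t
  proof -
    have "0 < t" using t \<open>0 < t\<^sub>0\<close> by simp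
    define n where "n = nat \<lceil>s t\<rceil>"
    have n: "n \<ge> 1" "s t \<le> real n" "real n \<le> s t + 1"
      using s_ge_1[OF t] unfolding n_def by linarith+
    let ?\<rho> = "approx_rho iX iY t"
    have "c\<^sub>Y * real n powr (- \<beta>) \<le> norm ((An n - A) o\<^sub>L iY)" by (rule lowerY[OF n(1)])
    also have "\<dots> \<le> norm (An n - A) * ?\<rho> + norm ((An n - A) o\<^sub>L iX) * t"
      using \<open>0 < t\<close> by (intro norm_compose_le_approx_rho) simp
    also have "\<dots> \<le> C\<^sub>Z * ?\<rho> + C\<^sub>X * real n powr (- \<alpha>) * t"
      using \<open>0 < t\<close> by (intro add_mono mult_right_mono upperX[OF n(1)] upperZ[OF n(1)] approx_rho_nonneg) auto
    also have "C\<^sub>X * real n powr (- \<alpha>) * t \<le> c\<^sub>Y / 2 * real n powr (- \<beta>)"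
      using balanced_index_powr[OF \<open>\<beta> < \<alpha>\<close> \<open>C\<^sub>X > 0\<close> \<open>c\<^sub>Y > 0\<close> \<open>0 < t\<close>, of "real n"] n(2)
      by (simp add: s_def mult_ac)
    finally have "c\<^sub>Y / 2 * real n powr (- \<beta>) \<le> C\<^sub>Z * ?\<rho>" by simp
    \<comment> \<open>The base on the left is \<open>s t + 1\<close>, an upper bound for
      \<open>n\<close>; the exponent is nonpositive, so the order reverses.\<close>
    moreover have "(s t * (1 + 1 / s t)) powr (- \<beta>) \<le> real n powr (- \<beta>)"
      using n s_ge_1[OF t] \<open>0 \<le> \<beta>\<close> by (intro powr_mono2') (auto simp: distrib_left)
    ultimately have "c\<^sub>Y / 2 * (s t * (1 + 1 / s t)) powr (- \<beta>) \<le> C\<^sub>Z * ?\<rho>"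
      using mult_left_mono[of "(s t * (1 + 1 / s t)) powr (- \<beta>)" "real n powr (- \<beta>)" "c\<^sub>Y / 2"] pos
      by linarith
    also have "c\<^sub>Y / 2 * (s t * (1 + 1 / s t)) powr (- \<beta>)
        = c\<^sub>Y / 2 * s t powr (- \<beta>) * (1 + 1 / s t) powr (- \<beta>)"
      by (simp only: powr_mult mult.assoc)
    also have "\<dots> = C\<^sub>Z * (K * (1 + 1 / s t) powr (- \<beta>) * t powr (- \<gamma>))"
      unfolding K_eq[OF \<open>0 < t\<close>] by (simp only: mult_ac)
    finally have "C\<^sub>Z * (K * (1 + 1 / s t) powr (- \<beta>) * t powr (- \<gamma>)) \<le> C\<^sub>Z * ?\<rho>" .
    then show ?thesis using \<open>C\<^sub>Z > 0\<close> by simp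
  qed

  have "2 powr (- \<beta>) * K * t powr (- \<gamma>) \<le> approx_rho iX iY t" if t: "t\<^sub>0 \<le> t" for t
  proof -
    have "2 powr (- \<beta>) \<le> (1 + 1 / s t) powr (- \<beta>)"
      using s_ge_1[OF t] \<open>0 \<le> \<beta>\<close> by (intro powr_mono2') (auto simp: field_simps add_pos_pos)
    then have "2 powr (- \<beta>) * (K * t powr (- \<gamma>)) \<le> (1 + 1 / s t) powr (- \<beta>) * (K * t powr (- \<gamma>))"
      using \<open>K > 0\<close> by (intro mult_right_mono) auto
    also have "\<dots> \<le> approx_rho iX iY t" using key[OF t] by (simp add: mult_ac)
    finally show ?thesis by (simp add: mult_ac)
  qed
  moreover have "ereal K \<le> Liminf at_top (\<lambda>t. ereal (t powr \<gamma> * approx_rho iX iY t))"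
  proof -
    have "filterlim (\<lambda>t. (b * t) powr d) at_top at_top" if "0 < b" "0 < d" for b d :: real
      using that by real_asymp
    from this[of "2 * C\<^sub>X / c\<^sub>Y" "1 / (\<alpha> - \<beta>)"] have "filterlim s at_top at_top"
      using \<open>\<beta> < \<alpha>\<close> pos by (simp add: s_def[abs_def])
    then have "((\<lambda>t. 1 / s t) \<longlongrightarrow> 0) at_top"
      by (intro tendsto_divide_0[OF tendsto_const] filterlim_at_top_imp_at_infinity)
    then have "((\<lambda>t. K * (1 + 1 / s t) powr (- \<beta>)) \<longlongrightarrow> K * (1 + 0) powr (- \<beta>)) at_top"
      by (intro tendsto_intros) auto
    \<comment> \<open>Convergence is known only for the lower bound from \<open>key\<close>, not for
      the scaled \<rho>, so its limit is read as a \<open>Liminf\<close> and compared by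
      monotonicity.\<close>
    then have "ereal K = Liminf at_top (\<lambda>t. ereal (K * (1 + 1 / s t) powr (- \<beta>)))"
      by (intro lim_imp_Liminf[symmetric]) auto
    also have "\<dots> \<le> Liminf at_top (\<lambda>t. ereal (t powr \<gamma> * approx_rho iX iY t))"
    proof (rule Liminf_mono)
      show "\<forall>\<^sub>F t in at_top. ereal (K * (1 + 1 / s t) powr (- \<beta>)) \<le> ereal (t powr \<gamma> * approx_rho iX iY t)"
        using eventually_ge_at_top[of t\<^sub>0]
      proof eventually_elim
        case (elim t)
        then have "0 < t" using \<open>0 < t\<^sub>0\<close> by simp
        then have "K * (1 + 1 / s t) powr (- \<beta>)
            = t powr \<gamma> * (K * (1 + 1 / s t) powr (- \<beta>) * t powr (- \<gamma>))"
          by (simp add: powr_minus field_simps)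
        also have "\<dots> \<le> t powr \<gamma> * approx_rho iX iY t"
          using key[OF elim] by (rule mult_left_mono) simp
        finally show ?case by simp
      qed
    qed
    finally show ?thesis .
  qed
  ultimately show ?thesis
    unfolding K_def \<gamma>_def t\<^sub>0_def by blast
qed

end
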